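(* Let $G_1$ be a graph that admits perfect state transfer between vertices $x$ and $y$ at time $\pi/g$, where $g$ is defined as follows: $\lambda_0$ is the largest eigenvalue of $A(G_1)$, the eigenvalues in $\operatorname{supp}_{G_1}(x)$ have the form $\lambda=\frac12(a+b_\lambda\sqrt{\Delta})$ with integers $a,b_\lambda$ and a square-free integer $\Delta$ (with $\Delta=1$ if they are all integers), and $g=\gcd\{(\lambda_0-\lambda)/\sqrt{\Delta}:\lambda\in\operatorname{supp}_{G_1}(x)\}$. Let $n_2\ge1$. If $\sqrt{4n_2+1}$ is not an integer, then $G_1\bigstar\overline{K_{n_2}}$ admits pretty good state transfer between the vertices $(x,0)$ and $(y,0)$.
   Context: All graphs are finite, simple and undirected; $\overline{K_{n_2}}$ is the edgeless graph on $n_2$ vertices. For graphs $G_1$ (order $n_1$) and $G_2$, the neighborhood corona $G_1\bigstar G_2$ is obtained from one copy of $G_1$ and $n_1$ copies of $G_2$ by joining every neighbor (in $G_1$) of the $i$-th vertex of $G_1$ to every vertex of the $i$-th copy of $G_2$; its vertex set is $V(G_1)\times(\{0\}\cup V(G_2))$, where $(x,0)$ denotes vertex $x$ of $G_1$. For a graph $G$ with adjacency matrix $A(G)$ let $U(t)=\exp(-itA(G))$. $f_\lambda(G)$ is the orthogonal projection onto the $\lambda$-eigenspace and $\operatorname{supp}_G(x)=\{\lambda: f_\lambda(G)e_x\neq0\}$. $G$ admits perfect state transfer between $x,y$ at time $t$ if $U(t)e_x=\gamma e_y$ with $|\gamma|=1$. $G$ admits pretty good state transfer between $x,y$ if for every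 $\epsilon>0$ there is a time $\tau$ with $|e_y^TU(\tau)e_x|>1-\epsilon$. *)

theory Defs
  imports "HOL-Analysis.Analysis" "HOL-Computational_Algebra.Squarefree"
begin

text \<open>A graph is given by its adjacency relation on a finite vertex type; the vertex set is the whole
  type.\<close>

definition simple_graph :: "('a \<Rightarrow> 'a \<Rightarrow> bool) \<Rightarrow> bool" where
  "simple_graph G \<longleftrightarrow> symp G \<and> irreflp G"

definition edgeless :: "'a \<Rightarrow> 'a \<Rightarrow> bool" where
  "edgeless u v \<longleftrightarrow> False"

text \<open>The vertex \<open>(i, None)\<close> is the vertex \<open>i\<close> of the copy of the first graph, usually written
  \<open>(i, 0)\<close>; \<open>(i, Some u)\<close> is the vertex \<open>u\<close> of the \<open>i\<close>-th copy of the second graph.\<close>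

fun neighborhood_corona ::
  "('a \<Rightarrow> 'a \<Rightarrow> bool) \<Rightarrow> ('b \<Rightarrow> 'b \<Rightarrow> bool) \<Rightarrow> 'a \<times> 'b option \<Rightarrow> 'a \<times> 'b option \<Rightarrow> bool" where
  "neighborhood_corona G H (i, None) (j, None) \<longleftrightarrow> G i j"
| "neighborhood_corona G H (i, None) (j, Some v) \<longleftrightarrow> G i j"
| "neighborhood_corona G H (i, Some u) (j, None) \<longleftrightarrow> G i j"
| "neighborhood_corona G H (i, Some u) (j, Some v) \<longleftrightarrow> i = j \<and> H u v"

lemma simple_graph_neighborhood_corona:
  assumes "simple_graph G" "simple_graph H"
  shows "simple_graph (neighborhood_corona G H)"
  unfolding simple_graph_def
proof
  show "symp (neighborhood_corona G H)"
  proof (rule sympI)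
    fix p q assume "neighborhood_corona G H p q"
    with assms show "neighborhood_corona G H q p"
      by (cases "(G, H, p, q)" rule: neighborhood_corona.cases)
        (auto simp: simple_graph_def dest: sympD)
  qed
  show "irreflp (neighborhood_corona G H)"
  proof (rule irreflpI)
    fix p
    show "\<not> neighborhood_corona G H p p"
      using assms by (cases p; cases "snd p") (auto simp: simple_graph_def irreflp_def)
  qed
qed

definition adjacency_matrix :: "('a::finite \<Rightarrow> 'a \<Rightarrow> bool) \<Rightarrow> real^'a^'a" where
  "adjacency_matrix G = (\<chi> i j. of_bool (G i j))"

text \<open>The adjacency matrix is real symmetric, so its eigenvalues are real and the complex eigenspaces
  and eigenprojections are the complexifications of the real ones used here.\<close>

definition eigenspace :: "real^'a^'a::finite \<Rightarrow> real \<Rightarrow> (real^'a) set" where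
  "eigenspace A l = {v. A *v v = l *\<^sub>R v}"

definition eigenvalues :: "real^'a^'a::finite \<Rightarrow> real set" where
  "eigenvalues A = {l. \<exists>v. v \<noteq> 0 \<and> A *v v = l *\<^sub>R v}"

definition largest_eigenvalue :: "('a::finite \<Rightarrow> 'a \<Rightarrow> bool) \<Rightarrow> real" where
  "largest_eigenvalue G = Max (eigenvalues (adjacency_matrix G))"

definition orthogonal_projection :: "'v::euclidean_space set \<Rightarrow> 'v \<Rightarrow> 'v" where
  "orthogonal_projection S v = (THE w. w \<in> S \<and> (\<forall>z\<in>S. orthogonal (v - w) z))"

lemma orthogonal_projection_unique_existence:
  fixes S :: "'v::euclidean_space set"
  assumes "subspace S"
  shows "\<exists>!w. w \<in> S \<and> (\<forall>z\<in>S. orthogonal (v - w) z)"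
proof -
  obtain y z where yz: "y \<in> span S" "\<And>w. w \<in> span S \<Longrightarrow> orthogonal z w" "v = y + z"
    using orthogonal_subspace_decomp_exists[of S v] by metis
  have S: "span S = S" using assms by (simp add: span_eq_iff)
  show ?thesis
  proof (rule ex1I[of _ y])
    show "y \<in> S \<and> (\<forall>z\<in>S. orthogonal (v - y) z)" using yz S by auto
  next
    fix w assume w: "w \<in> S \<and> (\<forall>z\<in>S. orthogonal (v - w) z)"
    have d: "y - w \<in> S" using w yz S assms by (simp add: subspace_diff)
    have "orthogonal (v - w) (y - w)" "orthogonal (v - y) (y - w)" using w yz S d by auto
    hence "(y - w) \<bullet> (y - w) = 0"
      by (simp add: orthogonal_def inner_diff_left)
    thus "w = y" by simp
  qed
qed

definition eigenprojection :: "('a::finite \<Rightarrow> 'a \<Rightarrow> bool) \<Rightarrow> real \<Rightarrow> real^'a \<Rightarrow> real^'a" where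
  "eigenprojection G l = orthogonal_projection (eigenspace (adjacency_matrix G) l)"

text \<open>If \<open>l\<close> is not an eigenvalue, then the eigenspace and hence the projection is zero.\<close>

definition eigenvalue_support :: "('a::finite \<Rightarrow> 'a \<Rightarrow> bool) \<Rightarrow> 'a \<Rightarrow> real set" where
  "eigenvalue_support G x = {l. eigenprojection G l (axis x 1) \<noteq> 0}"

text \<open>Square matrices over \<open>complex\<close> are not an instance of the class in which \<^const>\<open>exp\<close> is
  defined (multiplication of vectors is componentwise), hence the explicit series.\<close>

definition matrix_exp :: "complex^'a^'a::finite \<Rightarrow> complex^'a^'a" where
  "matrix_exp M = (\<Sum>k. (((**) M ^^ k) (mat 1)) /\<^sub>R fact k)"

definition transition_matrix :: "('a::finite \<Rightarrow> 'a \<Rightarrow> bool) \<Rightarrow> real \<Rightarrow> complex^'a^'a" where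
  "transition_matrix G t =
     matrix_exp (map_matrix (\<lambda>r. - \<i> * of_real t * of_real r) (adjacency_matrix G))"

definition perfect_state_transfer :: "('a::finite \<Rightarrow> 'a \<Rightarrow> bool) \<Rightarrow> 'a \<Rightarrow> 'a \<Rightarrow> real \<Rightarrow> bool" where
  "perfect_state_transfer G x y t \<longleftrightarrow>
     (\<exists>\<gamma>::complex. norm \<gamma> = 1 \<and> transition_matrix G t *v axis x 1 = \<gamma> *s axis y 1)"

text \<open>The \<open>y\<close>-component of a vector is its product with the transpose of the unit vector at \<open>y\<close>.\<close>

definition pretty_good_state_transfer :: "('a::finite \<Rightarrow> 'a \<Rightarrow> bool) \<Rightarrow> 'a \<Rightarrow> 'a \<Rightarrow> bool" where
  "pretty_good_state_transfer G x y \<longleftrightarrow>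
     (\<forall>\<epsilon>>0. \<exists>\<tau>. norm ((transition_matrix G \<tau> *v axis x 1) $ y) > 1 - \<epsilon>)"

text \<open>If every eigenvalue in the support is \<open>(a + b * sqrt \<Delta>) / 2\<close> for fixed integers \<open>a\<close> and
  \<open>\<Delta>\<close>, and the largest eigenvalue lies in the support (as in a connected graph), then all the
  quotients are integers, because eigenvalues are algebraic integers. For a disconnected graph
  they are either all integers or all non-integers; in the latter case this is \<open>Gcd {} = 0\<close>.\<close>

definition support_gcd :: "('a::finite \<Rightarrow> 'a \<Rightarrow> bool) \<Rightarrow> 'a \<Rightarrow> nat \<Rightarrow> int" where
  "support_gcd G x \<Delta> =
     Gcd {k. \<exists>l\<in>eigenvalue_support G x. of_int k = (largest_eigenvalue G - l) / sqrt (real \<Delta>)}"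

end

(* With m = n_2, the adjacency matrix of the corona is the Kronecker product of A(G_1) with the
   adjacency matrix of a star with m leaves and a loop at its centre. The latter has eigenvalues
   (1 + s)/2 and (1 - s)/2 with s = sqrt (4 m + 1), besides 0 on vectors that vanish at the centre.
   So an eigenvalue l of G_1 contributes exp (-i t l / 2) exp (-/+ i t l s / 2) at the vertices (_, 0).
   If 2 l is an integer for every l in the support, then t = 2 (pi/g + 4 pi n) makes the first factor
   exp (-i pi l / g), as in the perfect state transfer of G_1, and since s is irrational, n can be
   chosen so that the second factor is close to 1 for all l. The case Delta > 1 is degenerate: the
   time pi/g carries no factor sqrt Delta, so perfect state transfer forces a one-element support
   and x = y. *)

theory Submission
  imports Defs "HOL-Computational_Algebra.Polynomial"
begin

section \<open>Irrational square roots\<close>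

text \<open>The root is an algebraic integer, and a rational algebraic integer is an
  integer.\<close>

lemma sqrt_of_nat_irrational:
  assumes "sqrt (real n) \<notin> \<int>"
  shows "sqrt (real n) \<notin> \<rat>"
  using assms rational_algebraic_int_is_int[of "sqrt (real n)"] by auto

text \<open>An integral root would make \<open>n\<close> a perfect square, and 1 is the only
  squarefree square.\<close>

lemma sqrt_squarefree_irrational:
  assumes "squarefree n" "n \<noteq> 1"
  shows "sqrt (real n) \<notin> \<rat>"
proof (rule sqrt_of_nat_irrational, rule notI)
  assume "sqrt (real n) \<in> \<int>"
  then obtain k where k: "sqrt (real n) = of_int k" by (auto elim: Ints_cases)
  have "0 \<le> k" using k by (metis of_int_0_le_iff of_nat_0_le_iff real_sqrt_ge_zero)
  then obtain j where j: "k = int j" using nonneg_int_cases by blast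
  have "real n = (real j)\<^sup>2" using k j by (metis of_int_of_nat_eq of_nat_0_le_iff real_sqrt_pow2)
  hence "n = j\<^sup>2" by (metis of_nat_eq_iff of_nat_power)
  thus False using assms by (auto simp: squarefree_def)
qed

section \<open>The spectral theorem for real symmetric matrices\<close>

text \<open>The Rayleigh quotient attains its maximum on the unit sphere of \<open>W\<close>, and a
  maximizer is an eigenvector.\<close>

lemma selfadjoint_eigenvector_exists:
  fixes f :: "'v::euclidean_space \<Rightarrow> 'v"
  assumes lin: "linear f" and adj: "\<And>x y. f x \<bullet> y = x \<bullet> f y"
    and W: "subspace W" "f ` W \<subseteq> W" "w0 \<in> W" "w0 \<noteq> 0"
  obtains v l where "v \<in> W" "v \<noteq> 0" "f v = l *\<^sub>R v"
proof -
  let ?S = "sphere 0 1 \<inter> W"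
  have "compact ?S" using W(1) by (simp add: closed_subspace compact_Int_closed)
  moreover have "w0 /\<^sub>R norm w0 \<in> ?S" using W by (auto intro: subspace_scale)
  moreover have "continuous_on ?S (\<lambda>x. x \<bullet> f x)"
    using lin by (intro continuous_intros linear_continuous_on) (simp add: linear_conv_bounded_linear)
  ultimately obtain v where v: "v \<in> ?S" and max: "\<And>u. u \<in> ?S \<Longrightarrow> u \<bullet> f u \<le> v \<bullet> f v"
    using continuous_attains_sup[of ?S "\<lambda>x. x \<bullet> f x"] by blast
  define l where "l = v \<bullet> f v"
  \<comment> \<open>By maximality of \<open>l\<close>, \<open>h\<close> is positive semidefinite on
    \<open>W\<close>, and its quadratic form vanishes at \<open>v\<close>. It remains to conclude
    that \<open>h v = 0\<close>.\<close>
  define h where "h u = l *\<^sub>R u - f u" for u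
  have hlin: "h (u + c *\<^sub>R w) = h u + c *\<^sub>R h w" for u w c
    unfolding h_def using lin by (simp add: linear_add linear_scale algebra_simps)
  have hadj: "h u \<bullet> w = u \<bullet> h w" for u w
    unfolding h_def by (simp add: adj inner_diff_left inner_diff_right)
  have hW: "h u \<in> W" if "u \<in> W" for u
    unfolding h_def using that W by (auto intro: subspace_diff subspace_scale)
  have nonneg: "0 \<le> u \<bullet> h u" if "u \<in> W" for u
  proof (cases "u = 0")
    case False
    have "u /\<^sub>R norm u \<in> ?S" using W that False by (auto intro: subspace_scale)
    from max[OF this] have "(u \<bullet> f u) / (norm u)\<^sup>2 \<le> l"
      using lin by (simp add: linear_scale l_def power2_eq_square divide_inverse mult.commute mult.left_commute)
    hence "u \<bullet> f u \<le> l * (norm u)\<^sup>2" using False by (simp add: divide_simps)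
    thus ?thesis by (simp add: h_def inner_diff_right power2_norm_eq_inner)
  qed simp
  have hv: "v \<bullet> h v = 0"
    using v by (simp add: h_def inner_diff_right l_def norm_eq_1)
  define q where "q = h v \<bullet> h (h v)"
  define c where "c = h v \<bullet> h v"
  have vW: "v \<in> W" using v by simp
  have q0: "0 \<le> q" unfolding q_def using nonneg hW vW by blast
  have "c = 0"
  proof (rule ccontr)
    assume "c \<noteq> 0"
    hence c0: "0 < c" unfolding c_def by (metis inner_ge_zero less_eq_real_def)
    \<comment> \<open>At \<open>v - e h v\<close> the quadratic form of \<open>h\<close> equals
      \<open>e (e q - 2 c)\<close>. This \<open>e\<close> is small enough that
      \<open>e q \<le> c\<close>, which makes the value negative; adding 1 avoids division by zero
      if \<open>q = 0\<close>.\<close>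
    define e where "e = c / (q + 1)"
    have e0: "0 < e" using c0 q0 by (simp add: e_def)
    have "v + (-e) *\<^sub>R h v \<in> W" using vW hW W(1) by (blast intro: subspace_add subspace_scale)
    from nonneg[OF this] have "0 \<le> v \<bullet> h v - e * (v \<bullet> h (h v)) - e * c + e * e * q"
      by (simp only: hlin) (simp add: algebra_simps q_def c_def)
    also have "v \<bullet> h (h v) = c" by (simp add: c_def flip: hadj)
    finally have "0 \<le> e * (e * q - 2 * c)" using hv by (simp add: algebra_simps)
    hence "2 * c \<le> e * q" using e0 by (simp add: zero_le_mult_iff)
    also have "\<dots> \<le> c" unfolding e_def using c0 q0 by (simp add: divide_simps)
    finally show False using c0 by simp
  qed
  hence "f v = l *\<^sub>R v" by (simp add: c_def h_def)
  moreover have "v \<noteq> 0" using v by auto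
  ultimately show thesis using that vW by blast
qed

lemma orthogonal_projection_properties:
  fixes S :: "'v::euclidean_space set"
  assumes "subspace S"
  shows "orthogonal_projection S v \<in> S"
    and "z \<in> S \<Longrightarrow> orthogonal_projection S v \<bullet> z = v \<bullet> z"
proof -
  have *: "orthogonal_projection S v \<in> S \<and> (\<forall>z\<in>S. orthogonal (v - orthogonal_projection S v) z)"
    unfolding orthogonal_projection_def
    by (rule theI'[OF orthogonal_projection_unique_existence[OF assms]])
  thus "orthogonal_projection S v \<in> S" by blast
  show "orthogonal_projection S v \<bullet> z = v \<bullet> z" if "z \<in> S"
    using * that by (auto simp: orthogonal_def inner_diff_left)
qed

lemma subspace_eigenspace: "subspace (eigenspace A l)"
  unfolding eigenspace_def
  by (auto simp: subspace_def matrix_vector_right_distrib scaleR_right_distrib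
      matrix_vector_mult_scaleR mult.commute)

lemma selfadjoint_eigenspaces_orthogonal:
  assumes adj: "\<And>x y. (A *v x) \<bullet> y = x \<bullet> (A *v y)"
    and "u \<in> eigenspace A l" "w \<in> eigenspace A m" "l \<noteq> m"
  shows "u \<bullet> w = 0"
proof -
  have "l * (u \<bullet> w) = m * (u \<bullet> w)"
    using adj[of u w] assms(2,3) by (simp add: eigenspace_def)
  thus ?thesis using \<open>l \<noteq> m\<close> by simp
qed

text \<open>Eigenvectors chosen for distinct eigenvalues are nonzero and pairwise orthogonal, hence
  distinct and independent, and the space has finite dimension.\<close>

lemma finite_eigenvalues:
  assumes adj: "\<And>x y. (A *v x) \<bullet> y = x \<bullet> (A *v y)"
  shows "finite (eigenvalues A)"
proof -
  have "\<forall>l\<in>eigenvalues A. \<exists>v. v \<noteq> 0 \<and> v \<in> eigenspace A l"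
    by (auto simp: eigenvalues_def eigenspace_def)
  then obtain w where w: "\<And>l. l \<in> eigenvalues A \<Longrightarrow> w l \<noteq> 0 \<and> w l \<in> eigenspace A l"
    by metis
  have orth: "w l \<bullet> w m = 0" if "l \<in> eigenvalues A" "m \<in> eigenvalues A" "l \<noteq> m" for l m
    using selfadjoint_eigenspaces_orthogonal[OF adj] w that by blast
  have "pairwise orthogonal (w ` eigenvalues A)"
    by (auto simp: pairwise_def orthogonal_def) (metis orth)
  moreover have "0 \<notin> w ` eigenvalues A" using w by auto
  ultimately have "finite (w ` eigenvalues A)"
    using pairwise_orthogonal_independent independent_imp_finite by blast
  moreover have "inj_on w (eigenvalues A)"
    by (rule inj_onI) (metis orth w inner_eq_zero_iff)
  ultimately show ?thesis using finite_imageD by blast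
qed

text \<open>The difference \<open>r\<close> of the two sides lies in the common orthogonal
  complement \<open>W\<close> of all eigenspaces. As \<open>W\<close> is invariant under
  \<open>A\<close>, a nonzero \<open>r\<close> would yield an eigenvector in \<open>W\<close>, which
  would be orthogonal to itself.\<close>

lemma spectral_decomposition:
  fixes A :: "real^'a^'a::finite"
  assumes adj: "\<And>x y. (A *v x) \<bullet> y = x \<bullet> (A *v y)"
  shows "v = (\<Sum>l\<in>eigenvalues A. orthogonal_projection (eigenspace A l) v)"
proof -
  let ?P = "\<lambda>l. orthogonal_projection (eigenspace A l) v"
  define r where "r = v - (\<Sum>l\<in>eigenvalues A. ?P l)"
  define W where "W = {w. \<forall>l. \<forall>u\<in>eigenspace A l. w \<bullet> u = 0}"
  have "r \<bullet> u = 0" if u: "u \<in> eigenspace A m" for m u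
  proof (cases "u = 0")
    case False
    hence m: "m \<in> eigenvalues A" using u by (auto simp: eigenvalues_def eigenspace_def)
    have "(\<Sum>l\<in>eigenvalues A. ?P l) \<bullet> u = (\<Sum>l\<in>eigenvalues A. if l = m then ?P m \<bullet> u else 0)"
      unfolding inner_sum_left
      by (rule sum.cong) (auto intro: selfadjoint_eigenspaces_orthogonal[OF adj _ u]
          orthogonal_projection_properties(1)[OF subspace_eigenspace])
    also have "\<dots> = v \<bullet> u"
      using m finite_eigenvalues[OF adj]
      by (simp add: orthogonal_projection_properties(2)[OF subspace_eigenspace u])
    finally show ?thesis by (simp add: r_def inner_diff_left)
  qed simp
  hence rW: "r \<in> W" by (auto simp: W_def)
  have W: "subspace W" by (auto simp: W_def subspace_def inner_add_left)
  have AW: "(*v) A ` W \<subseteq> W"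
    by (auto simp: W_def adj eigenspace_def) blast
  have "r = 0"
  proof (rule ccontr)
    assume "r \<noteq> 0"
    then obtain u l where "u \<in> W" "u \<noteq> 0" "A *v u = l *\<^sub>R u"
      using selfadjoint_eigenvector_exists[OF matrix_vector_mul_linear adj W AW rW] by blast
    hence "u \<bullet> u = 0" by (auto simp: W_def eigenspace_def)
    thus False using \<open>u \<noteq> 0\<close> by simp
  qed
  thus ?thesis by (simp add: r_def)
qed

section \<open>The matrix exponential on eigenvectors\<close>

definition complex_vec :: "real^'a \<Rightarrow> complex^'a" where
  "complex_vec v = (\<chi> i. of_real (v $ i))"

lemma complex_vec_axis: "complex_vec (axis x 1) = axis x 1"
  by (simp add: complex_vec_def axis_def vec_eq_iff)

lemma complex_vec_sum: "complex_vec (\<Sum>l\<in>S. v l) = (\<Sum>l\<in>S. complex_vec (v l))"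
  by (simp add: complex_vec_def vec_eq_iff)

text \<open>The \<open>k\<close>-th power of \<open>M\<close> multiplies \<open>v\<close> by
  \<open>c ^ k\<close>, so the series applied to \<open>v\<close> is the scalar exponential series.
  Its convergence has to be shown before it can be applied termwise.\<close>

lemma matrix_exp_eigenvector:
  fixes M :: "complex^'a^'a::finite"
  assumes "M *v v = c *s v"
  shows "matrix_exp M *v v = exp c *s v"
proof -
  let ?T = "\<lambda>k. (((**) M ^^ k) (mat 1)) /\<^sub>R fact k"
  \<comment> \<open>Left multiplication by \<open>M\<close> is bounded; its constant
    \<open>K\<close> makes the series of \<open>exp K\<close> a majorant.\<close>
  have "linear ((**) M :: complex^'a^'a \<Rightarrow> _)"
    by (rule linearI) (simp_all add: matrix_add_ldistrib matrix_scalar_ac scalar_matrix_assoc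
        vec_eq_iff matrix_matrix_mult_def scaleR_sum_right distrib_left sum.distrib)
  hence "bounded_linear ((**) M :: complex^'a^'a \<Rightarrow> _)" by (simp add: linear_conv_bounded_linear)
  then obtain K where K: "0 < K" "\<And>X :: complex^'a^'a. norm (M ** X) \<le> norm X * K"
    using bounded_linear.pos_bounded by blast
  have bound: "norm (((**) M ^^ k) (mat 1)) \<le> K ^ k * norm (mat 1 :: complex^'a^'a)" for k
  proof (induction k)
    case (Suc k)
    have "norm (((**) M ^^ Suc k) (mat 1)) \<le> norm (((**) M ^^ k) (mat 1)) * K" using K by simp
    also have "\<dots> \<le> K ^ k * norm (mat 1 :: complex^'a^'a) * K"
      using Suc K by (intro mult_right_mono) auto
    finally show ?case by (simp add: mult_ac)
  qed simp
  have "summable ?T"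
  proof (rule summable_comparison_test)
    show "summable (\<lambda>k. norm (mat 1 :: complex^'a^'a) * (inverse (fact k) * K ^ k))"
      by (intro summable_mult summable_exp)
    show "\<exists>N. \<forall>n\<ge>N. norm (?T n) \<le> norm (mat 1 :: complex^'a^'a) * (inverse (fact n) * K ^ n)"
      using bound by (auto simp: divide_simps mult_ac)
  qed
  hence "?T sums matrix_exp M" unfolding matrix_exp_def by (rule summable_sums)
  moreover have "bounded_linear (\<lambda>X::complex^'a^'a. X *v v)"
    unfolding linear_conv_bounded_linear[symmetric]
    by (rule linearI) (simp_all add: vec_eq_iff matrix_vector_mult_def scaleR_sum_right
        distrib_right sum.distrib)
  ultimately have "(\<lambda>k. ?T k *v v) sums (matrix_exp M *v v)"
    using bounded_linear.sums by blast
  moreover have "?T k *v v = (c ^ k /\<^sub>R fact k) *s v" for k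
  proof -
    have "?T k *v v = (((**) M ^^ k) (mat 1) *v v) /\<^sub>R fact k"
      by (simp add: vec_eq_iff matrix_vector_mult_def scaleR_sum_right)
    moreover have "((**) M ^^ k) (mat 1) *v v = c ^ k *s v"
      by (induction k)
        (simp_all add: matrix_vector_mul_assoc[symmetric] vector_scalar_commute assms mult.commute)
    ultimately show ?thesis by (simp add: vec_eq_iff)
  qed
  ultimately have "(\<lambda>k. (c ^ k /\<^sub>R fact k) *s v) sums (matrix_exp M *v v)" by simp
  moreover have "bounded_linear (\<lambda>z::complex. z *s v)"
    unfolding linear_conv_bounded_linear[symmetric]
    by (rule linearI) (simp_all add: vec_eq_iff distrib_right)
  hence "(\<lambda>k. (c ^ k /\<^sub>R fact k) *s v) sums (exp c *s v)"
    using bounded_linear.sums[OF _ exp_converges[of c]] by blast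
  ultimately show ?thesis using sums_unique2 by blast
qed

lemma transition_matrix_eigenvector:
  assumes "v \<in> eigenspace (adjacency_matrix G) l"
  shows "transition_matrix G t *v complex_vec v = cis (- (t * l)) *s complex_vec v"
proof -
  let ?A = "adjacency_matrix G"
  have "(\<Sum>j\<in>UNIV. of_real (?A $ i $ j) * of_real (v $ j)) = (of_real (l * v $ i) :: complex)" for i
    using assms[unfolded eigenspace_def, simplified, unfolded vec_eq_iff, rule_format, of i]
    by (simp add: matrix_vector_mult_def flip: of_real_mult of_real_sum)
  hence "(\<Sum>j\<in>UNIV. - (\<i> * of_real t) * (of_real (?A $ i $ j) * of_real (v $ j))) =
      - (\<i> * of_real t) * (of_real (l * v $ i) :: complex)" for i
    by (metis sum_distrib_left)
  hence "map_matrix (\<lambda>r. - \<i> * of_real t * of_real r) ?A *v complex_vec v =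
      (- \<i> * of_real (t * l)) *s complex_vec v"
    by (simp add: vec_eq_iff matrix_vector_mult_def complex_vec_def map_matrix_def mult_ac)
  thus ?thesis
    unfolding transition_matrix_def by (simp add: matrix_exp_eigenvector cis_conv_exp)
qed

lemma matrix_vector_mult_scaled_sum:
  fixes M :: "complex^'n::finite^'m::finite"
  shows "M *v (\<Sum>k\<in>S. c k *s u k) = (\<Sum>k\<in>S. c k *s (M *v u k))"
  by (induction S rule: infinite_finite_induct)
    (simp_all add: matrix_vector_right_distrib vector_scalar_commute)

lemma transition_matrix_eigenvector_sum:
  assumes "\<And>k. k \<in> S \<Longrightarrow> w k \<in> eigenspace (adjacency_matrix G) (l k)"
  shows "transition_matrix G t *v (\<Sum>k\<in>S. c k *s complex_vec (w k)) =
    (\<Sum>k\<in>S. (c k * cis (- (t * l k))) *s complex_vec (w k))"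
  unfolding matrix_vector_mult_scaled_sum
  by (intro sum.cong refl) (simp add: transition_matrix_eigenvector[OF assms])

section \<open>Spectral form of the evolution from a vertex\<close>

lemma adjacency_matrix_selfadjoint:
  assumes "simple_graph G"
  shows "(adjacency_matrix G *v u) \<bullet> w = u \<bullet> (adjacency_matrix G *v w)"
proof -
  have "transpose (adjacency_matrix G) = adjacency_matrix G"
    using assms by (auto simp: transpose_def adjacency_matrix_def vec_eq_iff simple_graph_def dest: sympD)
  thus ?thesis by (metis dot_lmul_matrix transpose_matrix_vector)
qed

lemma eigenprojection_in_eigenspace:
  "eigenprojection G l v \<in> eigenspace (adjacency_matrix G) l"
  unfolding eigenprojection_def by (rule orthogonal_projection_properties(1)[OF subspace_eigenspace])

lemma eigenprojection_inner:
  assumes "u \<in> eigenspace (adjacency_matrix G) l"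
  shows "eigenprojection G l v \<bullet> u = v \<bullet> u"
  unfolding eigenprojection_def
  by (rule orthogonal_projection_properties(2)[OF subspace_eigenspace assms])

lemma eigenvalue_support_subset: "eigenvalue_support G x \<subseteq> eigenvalues (adjacency_matrix G)"
  using eigenprojection_in_eigenspace[of G _ "axis x 1"]
  by (auto simp: eigenvalue_support_def eigenvalues_def eigenspace_def)

lemma finite_eigenvalue_support:
  "simple_graph G \<Longrightarrow> finite (eigenvalue_support G x)"
  using finite_eigenvalues[OF adjacency_matrix_selfadjoint] eigenvalue_support_subset
  by (metis finite_subset)

text \<open>In the spectral decomposition of the unit vector, eigenvalues outside the support
  contribute zero.\<close>

lemma axis_eigenprojection_sum:
  assumes "simple_graph G"
  shows "axis x 1 = (\<Sum>l\<in>eigenvalue_support G x. eigenprojection G l (axis x 1))"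
proof -
  have "axis x 1 = (\<Sum>l\<in>eigenvalues (adjacency_matrix G). eigenprojection G l (axis x 1))"
    unfolding eigenprojection_def
    by (rule spectral_decomposition) (rule adjacency_matrix_selfadjoint[OF assms])
  also have "\<dots> = (\<Sum>l\<in>eigenvalue_support G x. eigenprojection G l (axis x 1))"
    by (intro sum.mono_neutral_right eigenvalue_support_subset finite_eigenvalues
        adjacency_matrix_selfadjoint[OF assms]) (auto simp: eigenvalue_support_def)
  finally show ?thesis .
qed

lemma transition_matrix_axis:
  assumes "simple_graph G"
  shows "transition_matrix G t *v axis x 1 =
    (\<Sum>l\<in>eigenvalue_support G x. cis (- (t * l)) *s complex_vec (eigenprojection G l (axis x 1)))"
proof -
  have "axis x 1 = (\<Sum>l\<in>eigenvalue_support G x. 1 *s complex_vec (eigenprojection G l (axis x 1)))"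
    using axis_eigenprojection_sum[OF assms, of x]
    by (metis (no_types, lifting) complex_vec_axis complex_vec_sum sum.cong vector_smult_lid)
  thus ?thesis
    using transition_matrix_eigenvector_sum[of "eigenvalue_support G x"
        "\<lambda>l. eigenprojection G l (axis x 1)" G "\<lambda>l. l" t "\<lambda>_. 1", OF eigenprojection_in_eigenspace]
    by simp
qed

lemma transition_matrix_0_axis:
  assumes "simple_graph G"
  shows "transition_matrix G 0 *v axis x 1 = axis x 1"
proof -
  have "transition_matrix G 0 *v axis x 1 = complex_vec (axis x 1)"
    unfolding transition_matrix_axis[OF assms]
    by (subst (2) axis_eigenprojection_sum[OF assms]) (simp add: complex_vec_sum)
  thus ?thesis by (simp add: complex_vec_axis)
qed

text \<open>Time 0 suffices. This settles \<open>x = y\<close>, so the main argument may assume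
  distinct vertices.\<close>

lemma pretty_good_state_transfer_refl:
  "simple_graph G \<Longrightarrow> pretty_good_state_transfer G x x"
  unfolding pretty_good_state_transfer_def
  by (intro allI impI exI[of _ 0]) (simp add: transition_matrix_0_axis)

section \<open>Consequences of perfect state transfer\<close>

text \<open>Both degenerate situations of the main proof, transfer at time 0 and a one-element
  support, lead to such an equation.\<close>

lemma scaled_axis_eq_imp_eq:
  assumes "c *s axis x 1 = d *s (axis y 1 :: complex^'a::finite)" "c \<noteq> 0"
  shows "x = y"
  using assms(1)[unfolded vec_eq_iff, rule_format, of x] assms(2)
  by (auto simp: axis_def split: if_splits)

text \<open>Pair both sides of the transfer equation with \<open>u\<close>. By orthogonality only
  the component for \<open>m\<close> survives; if \<open>m\<close> is outside the support, that
  component is zero and so is \<open>u $ x\<close>.\<close>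

lemma perfect_state_transfer_phase:
  assumes G: "simple_graph G"
    and T: "transition_matrix G t *v axis x 1 = \<gamma> *s axis y 1"
    and u: "u \<in> eigenspace (adjacency_matrix G) m"
  shows "cis (- (t * m)) * of_real (u $ x) = \<gamma> * of_real (u $ y)"
proof (cases "u = 0")
  case False
  let ?S = "eigenvalue_support G x"
  let ?P = "\<lambda>l. eigenprojection G l (axis x 1)"
  have inner: "(\<Sum>j\<in>UNIV. of_real (u $ j) * complex_vec w $ j) = of_real (w \<bullet> u)" for w
    by (simp add: complex_vec_def inner_vec_def mult.commute)
  have orth: "?P l \<bullet> u = 0" if "l \<noteq> m" for l
    using selfadjoint_eigenspaces_orthogonal[OF adjacency_matrix_selfadjoint[OF G]
        eigenprojection_in_eigenspace u that] .
  have Pm: "?P m \<bullet> u = u $ x"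
    by (simp add: eigenprojection_inner[OF u] inner_axis')
  have "\<gamma> * of_real (u $ y) = (\<Sum>j\<in>UNIV. of_real (u $ j) * (\<gamma> *s axis y 1) $ j)"
    by (simp add: axis_def if_distrib cong: if_cong)
  also have "\<dots> = (\<Sum>j\<in>UNIV. \<Sum>l\<in>?S. cis (- (t * l)) * (of_real (u $ j) * complex_vec (?P l) $ j))"
    unfolding T[symmetric] transition_matrix_axis[OF G]
    by (simp add: sum_distrib_left mult_ac)
  also have "\<dots> = (\<Sum>l\<in>?S. cis (- (t * l)) * of_real (?P l \<bullet> u))"
    by (subst sum.swap) (simp add: inner flip: sum_distrib_left)
  also have "\<dots> = (\<Sum>l\<in>?S. if l = m then cis (- (t * m)) * of_real (u $ x) else 0)"
    by (rule sum.cong) (auto simp: orth Pm)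
  also have "\<dots> = cis (- (t * m)) * of_real (u $ x)"
  proof (cases "m \<in> ?S")
    case False
    hence "u $ x = 0" using Pm by (simp add: eigenvalue_support_def)
    thus ?thesis by (auto intro: sum.neutral)
  qed (simp add: finite_eigenvalue_support[OF G])
  finally show ?thesis by simp
qed simp

text \<open>The projections of a unit vector are real, so each phase \<open>exp (-i t l)\<close> on the support is
  \<open>\<gamma>\<close> or \<open>-\<gamma>\<close>.\<close>

lemma perfect_state_transfer_support_difference:
  assumes G: "simple_graph G" and T: "perfect_state_transfer G x y t"
    and l: "l \<in> eigenvalue_support G x" and m: "m \<in> eigenvalue_support G x"
  obtains k :: int where "t * (l - m) = of_int k * pi"
proof -
  obtain \<gamma> where \<gamma>: "norm \<gamma> = 1" "transition_matrix G t *v axis x 1 = \<gamma> *s axis y 1"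
    using T by (auto simp: perfect_state_transfer_def)
  have "\<exists>r::real. cis (- (t * l)) = \<gamma> * of_real r" if "l \<in> eigenvalue_support G x" for l
  proof -
    define u where "u = eigenprojection G l (axis x 1)"
    have u: "u \<in> eigenspace (adjacency_matrix G) l"
      by (simp add: u_def eigenprojection_in_eigenspace)
    \<comment> \<open>As \<open>u\<close> is a projection of the unit vector at \<open>x\<close>,
      its entry there is its squared norm, so it can be divided by.\<close>
    have "u \<bullet> u = u $ x" using eigenprojection_inner[OF u, of "axis x 1"]
      by (simp add: u_def[symmetric] inner_axis')
    moreover have "u \<noteq> 0" using that by (simp add: eigenvalue_support_def u_def)
    ultimately have "u $ x \<noteq> 0" by (metis inner_eq_zero_iff)
    hence "cis (- (t * l)) = \<gamma> * of_real (u $ y / u $ x)"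
      using perfect_state_transfer_phase[OF G \<gamma>(2) u] by (simp add: field_simps)
    thus ?thesis by blast
  qed
  from this[OF l] this[OF m] obtain r r' :: real
    where r: "cis (- (t * l)) = \<gamma> * of_real r" "cis (- (t * m)) = \<gamma> * of_real r'" by blast
  \<comment> \<open>In this product the unknown phase \<gamma> cancels against its conjugate, so the
    result is real.\<close>
  have "cis (t * (l - m)) = cnj (cis (- (t * l))) * cis (- (t * m))"
    by (simp add: cis_cnj cis_mult algebra_simps)
  also have "\<dots> = (cnj \<gamma> * \<gamma>) * of_real (r * r')" by (simp add: r)
  also have "cnj \<gamma> * \<gamma> = 1" using \<gamma>(1) complex_norm_square[of \<gamma>] by (simp add: mult.commute)
  finally have "Im (cis (t * (l - m))) = 0" by simp
  hence "sin (t * (l - m)) = 0" by simp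
  thus thesis using that by (auto simp: sin_zero_iff_int2)
qed

section \<open>Eigenvectors of the corona and its transition amplitudes\<close>

text \<open>The tensor product of \<open>v\<close> with a vector on the star with a looped centre:
  \<open>None\<close> is the centre and the other indices are the leaves.\<close>

definition corona_vec :: "real \<Rightarrow> real^'a::finite \<Rightarrow> real^('a \<times> 'm::finite option)" where
  "corona_vec \<alpha> v = (\<chi> p. (if snd p = None then \<alpha> else 1) * v $ fst p)"

text \<open>The condition on \<alpha> is the eigenvalue equation of the looped star at its centre;
  at a leaf the equation holds for every \<alpha>.\<close>

lemma corona_vec_in_eigenspace:
  fixes v :: "real^'a::finite"
  assumes v: "v \<in> eigenspace (adjacency_matrix G) l" and \<alpha>: "\<alpha>\<^sup>2 = \<alpha> + real CARD('m::finite)"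
  shows "corona_vec \<alpha> v \<in> eigenspace
    (adjacency_matrix (neighborhood_corona G (edgeless :: 'm \<Rightarrow> 'm \<Rightarrow> bool))) (l * \<alpha>)"
proof -
  let ?C = "neighborhood_corona G (edgeless :: 'm \<Rightarrow> 'm \<Rightarrow> bool)"
  have l: "(\<Sum>j\<in>UNIV. of_bool (G i j) * v $ j) = l * v $ i" for i
    using v[unfolded eigenspace_def, simplified, unfolded vec_eq_iff, rule_format, of i]
    by (simp add: matrix_vector_mult_def adjacency_matrix_def)
  have split: "(\<Sum>q\<in>UNIV. h q) = (\<Sum>j\<in>UNIV. h (j, None) + (\<Sum>w\<in>UNIV. h (j, Some w)))"
    for h :: "'a \<times> 'm option \<Rightarrow> real"
    by (simp add: UNIV_Times_UNIV[symmetric] sum.cartesian_product' UNIV_option_conv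
        sum.reindex del: UNIV_Times_UNIV)
  have "(\<Sum>q\<in>UNIV. of_bool (?C (i, None) q) * (corona_vec \<alpha> v :: real^('a \<times> 'm option)) $ q) =
      l * \<alpha> * (corona_vec \<alpha> v :: real^('a \<times> 'm option)) $ (i, None)" for i
  proof -
    have "(\<Sum>q\<in>UNIV. of_bool (?C (i, None) q) * (corona_vec \<alpha> v :: real^('a \<times> 'm option)) $ q) =
        (\<Sum>j\<in>UNIV. \<alpha>\<^sup>2 * (of_bool (G i j) * v $ j))"
      unfolding split by (intro sum.cong) (simp_all add: corona_vec_def \<alpha> algebra_simps)
    thus ?thesis unfolding sum_distrib_left[symmetric] l
      by (simp add: corona_vec_def power2_eq_square mult_ac)
  qed
  moreover have "(\<Sum>q\<in>UNIV. of_bool (?C (i, Some w) q) * (corona_vec \<alpha> v :: real^('a \<times> 'm option)) $ q) =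
      l * \<alpha> * (corona_vec \<alpha> v :: real^('a \<times> 'm option)) $ (i, Some w)" for i w
  proof -
    have "(\<Sum>q\<in>UNIV. of_bool (?C (i, Some w) q) * (corona_vec \<alpha> v :: real^('a \<times> 'm option)) $ q) =
        (\<Sum>j\<in>UNIV. \<alpha> * (of_bool (G i j) * v $ j))"
      unfolding split by (intro sum.cong) (simp_all add: corona_vec_def edgeless_def algebra_simps)
    thus ?thesis unfolding sum_distrib_left[symmetric] l
      by (simp add: corona_vec_def mult_ac)
  qed
  ultimately show ?thesis
    by (auto simp: eigenspace_def vec_eq_iff matrix_vector_mult_def adjacency_matrix_def
        split_paired_all) (metis option.exhaust)
qed

text \<open>The vectors for \<alpha> and \<beta> agree on the leaves, so their difference divided by
  \<open>\<alpha> - \<beta>\<close> is \<open>v\<close> on the centres and zero elsewhere. Summing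
  over the components of the unit vector at \<open>x\<close> writes the unit vector at
  \<open>(x, None)\<close> in eigenvectors of the corona.\<close>

lemma corona_transition_entry:
  fixes G :: "'a::finite \<Rightarrow> 'a \<Rightarrow> bool"
  assumes G: "simple_graph G"
    and \<alpha>: "\<alpha>\<^sup>2 = \<alpha> + real CARD('m::finite)" and \<beta>: "\<beta>\<^sup>2 = \<beta> + real CARD('m)" and "\<alpha> \<noteq> \<beta>"
  shows "(transition_matrix (neighborhood_corona G (edgeless :: 'm \<Rightarrow> 'm \<Rightarrow> bool)) t
      *v axis (x, None) 1) $ (y, None) =
    (\<Sum>l\<in>eigenvalue_support G x. of_real (eigenprojection G l (axis x 1) $ y / (\<alpha> - \<beta>)) *
      (of_real \<alpha> * cis (- (t * (l * \<alpha>))) - of_real \<beta> * cis (- (t * (l * \<beta>)))))"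
proof -
  let ?T = "transition_matrix (neighborhood_corona G (edgeless :: 'm \<Rightarrow> 'm \<Rightarrow> bool)) t"
  let ?S = "eigenvalue_support G x"
  let ?P = "\<lambda>l. eigenprojection G l (axis x 1)"
  let ?V = "\<lambda>\<alpha> l. corona_vec \<alpha> (?P l) :: real^('a \<times> 'm option)"
  define d :: complex where "d = of_real (1 / (\<alpha> - \<beta>))"
  have P: "(\<Sum>l\<in>?S. ?P l $ i) = (if i = x then 1 else 0)" for i
    using arg_cong[OF axis_eigenprojection_sum[OF G, of x], of "\<lambda>w. w $ i"]
    by (auto simp: axis_def)
  have "(axis (x, None) 1 :: complex^('a \<times> 'm option)) $ p =
      ((\<Sum>l\<in>?S. d *s complex_vec (?V \<alpha> l)) + (\<Sum>l\<in>?S. (- d) *s complex_vec (?V \<beta> l))) $ p" for p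
  proof -
    have "((\<Sum>l\<in>?S. d *s complex_vec (?V \<alpha> l)) + (\<Sum>l\<in>?S. (- d) *s complex_vec (?V \<beta> l))) $ p =
        of_real (((if snd p = None then \<alpha> else 1) - (if snd p = None then \<beta> else 1)) / (\<alpha> - \<beta>) *
          (\<Sum>l\<in>?S. ?P l $ fst p))"
      by (simp add: complex_vec_def corona_vec_def d_def sum_distrib_left sum_subtractf
          diff_divide_distrib left_diff_distrib sum_negf)
    also have "\<dots> = axis (x, None) 1 $ p"
      using \<open>\<alpha> \<noteq> \<beta>\<close> unfolding P by (cases p) (auto simp: axis_def)
    finally show ?thesis by simp
  qed
  hence "(axis (x, None) 1 :: complex^('a \<times> 'm option)) =
      (\<Sum>l\<in>?S. d *s complex_vec (?V \<alpha> l)) + (\<Sum>l\<in>?S. (- d) *s complex_vec (?V \<beta> l))"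
    unfolding vec_eq_iff by blast
  hence T: "?T *v axis (x, None) 1 =
      (\<Sum>l\<in>?S. (d * cis (- (t * (l * \<alpha>)))) *s complex_vec (?V \<alpha> l)) +
      (\<Sum>l\<in>?S. (- d * cis (- (t * (l * \<beta>)))) *s complex_vec (?V \<beta> l))"
    by (simp only: matrix_vector_right_distrib
        transition_matrix_eigenvector_sum[OF corona_vec_in_eigenspace[OF eigenprojection_in_eigenspace \<alpha>]]
        transition_matrix_eigenvector_sum[OF corona_vec_in_eigenspace[OF eigenprojection_in_eigenspace \<beta>]])
  show ?thesis
    unfolding T
    by (simp add: complex_vec_def corona_vec_def d_def algebra_simps diff_divide_distrib
        flip: sum.distrib)
qed

section \<open>Pretty good state transfer in the corona\<close>

theorem theorem5p1:
  fixes G1 :: "'a::finite \<Rightarrow> 'a \<Rightarrow> bool"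
    and x y :: 'a
    and a :: int and b :: "real \<Rightarrow> int" and \<Delta> :: nat and g :: int
  assumes "simple_graph G1"
    and "squarefree \<Delta>"
    and "\<forall>l\<in>eigenvalue_support G1 x. l = (of_int a + of_int (b l) * sqrt (real \<Delta>)) / 2"
    and "eigenvalue_support G1 x \<subseteq> \<int> \<longrightarrow> \<Delta> = 1"
    and "g = support_gcd G1 x \<Delta>"
    and "perfect_state_transfer G1 x y (pi / of_int g)"
    and "sqrt (4 * real CARD('m::finite) + 1) \<notin> \<int>"
  shows "pretty_good_state_transfer
           (neighborhood_corona G1 (edgeless :: 'm \<Rightarrow> 'm \<Rightarrow> bool)) (x, None) (y, None)"
proof (cases "x = y")
  case True
  have "simple_graph (edgeless :: 'm \<Rightarrow> 'm \<Rightarrow> bool)"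
    by (auto simp: simple_graph_def edgeless_def symp_def irreflp_def)
  thus ?thesis
    using True assms(1) by (simp add: pretty_good_state_transfer_refl simple_graph_neighborhood_corona)
next
  case False
  let ?S = "eigenvalue_support G1 x"
  let ?P = "\<lambda>l. eigenprojection G1 l (axis x 1)"
  define \<tau> where "\<tau> = pi / of_int g"
  obtain \<gamma> where \<gamma>: "norm \<gamma> = 1" "transition_matrix G1 \<tau> *v axis x 1 = \<gamma> *s axis y 1"
    using assms(6) by (auto simp: perfect_state_transfer_def \<tau>_def)
  \<comment> \<open>Division by zero yields 0, so \<open>g = 0\<close> would mean transfer at time
    0, where nothing has moved.\<close>
  have g: "g \<noteq> 0"
  proof
    assume "g = 0"
    hence "1 *s axis x 1 = \<gamma> *s axis y 1"
      using \<gamma>(2) by (simp add: \<tau>_def transition_matrix_0_axis[OF assms(1)])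
    thus False using scaled_axis_eq_imp_eq[of 1 x \<gamma> y] False by simp
  qed
  have "\<Delta> = 1"
  proof (rule ccontr)
    assume "\<Delta> \<noteq> 1"
    hence irr: "sqrt (real \<Delta>) \<notin> \<rat>" using assms(2) sqrt_squarefree_irrational by blast
    \<comment> \<open>Transfer at time \<open>pi / g\<close> makes \<open>l - m\<close> an integer,
      while the given form makes it a rational multiple of the irrational root of \<Delta>; only
      zero is both.\<close>
    have eq: "l = m" if lm: "l \<in> ?S" "m \<in> ?S" for l m
    proof (rule ccontr)
      assume "l \<noteq> m"
      obtain k :: int where "\<tau> * (l - m) = of_int k * pi"
        using perfect_state_transfer_support_difference[OF assms(1) assms(6) lm] \<tau>_def by metis
      hence "pi * (l - m) = pi * of_int (k * g)" using g by (simp add: \<tau>_def field_simps)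
      hence k: "l - m = of_int (k * g)" by (simp only: mult_cancel_left pi_neq_zero simp_thms)
      have "l - m = of_int (b l - b m) * sqrt (real \<Delta>) / 2"
        using assms(3)[rule_format, OF lm(1)] assms(3)[rule_format, OF lm(2)]
        by (simp add: algebra_simps add_divide_distrib diff_divide_distrib)
      moreover from this have "b l \<noteq> b m" using \<open>l \<noteq> m\<close> by auto
      ultimately have "sqrt (real \<Delta>) = of_int (2 * (k * g)) / of_int (b l - b m)"
        using k by (simp add: field_simps)
      also have "\<dots> \<in> \<rat>" by (intro Rats_divide Rats_of_int)
      finally show False using irr by blast
    qed
    have "?S \<noteq> {}"
    proof
      assume "?S = {}"
      hence "axis x (1::real) = 0" using axis_eigenprojection_sum[OF assms(1), of x] by simp
      thus False by (simp add: axis_eq_0_iff)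
    qed
    then obtain m where m: "?S = {m}" using eq by blast
    \<comment> \<open>The unit vector is now itself an eigenvector, so it never leaves
      \<open>x\<close> and only changes its phase.\<close>
    hence "axis x 1 = ?P m" using axis_eigenprojection_sum[OF assms(1), of x] by simp
    hence "cis (- (\<tau> * m)) *s axis x 1 = \<gamma> *s axis y 1"
      using \<gamma>(2) transition_matrix_axis[OF assms(1), of \<tau> x] m by (simp add: complex_vec_axis)
    thus False using scaled_axis_eq_imp_eq[of "cis (- (\<tau> * m))" x \<gamma> y] False by simp
  qed
  \<comment> \<open>On the support this is the integer \<open>2 * l\<close>, since \<Delta> is
    1.\<close>
  define p where "p l = a + b l" for l
  have p: "l = of_int (p l) / 2" if "l \<in> ?S" for l
    using assms(3)[rule_format, OF that] \<open>\<Delta> = 1\<close> by (simp add: p_def)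
  \<comment> \<open>The eigenvalue equation of the looped star has the roots
    \<open>(1 + s) / 2\<close> and \<open>(1 - s) / 2\<close>.\<close>
  define s where "s = sqrt (4 * real CARD('m) + 1)"
  have s2: "s\<^sup>2 = 4 * real CARD('m) + 1" and s0: "0 < s"
    by (simp_all add: s_def add_nonneg_pos)
  have s_irr: "s \<notin> \<rat>"
    using sqrt_of_nat_irrational[of "4 * CARD('m) + 1"] assms(7) by (simp add: s_def add.commute)
  \<comment> \<open>The corona amplitude as a function of the phase error \<open>z\<close>. Without
    error the two star terms combine to \<open>s\<close>, which cancels, and the amplitude of the
    perfect transfer in \<open>G1\<close> remains. Since all \<open>p l\<close> are integers, one
    small \<open>z\<close>, needed only modulo 1, serves the whole support.\<close>
  define F :: "real \<Rightarrow> complex" where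
    "F z = (\<Sum>l\<in>?S. of_real (?P l $ y / s) * (cis (- (\<tau> * l)) *
      (of_real ((1 + s) / 2) * cis (- (2 * pi * of_int (p l) * z)) -
       of_real ((1 - s) / 2) * cis (2 * pi * of_int (p l) * z))))" for z
  have "F 0 = (\<Sum>l\<in>?S. cis (- (\<tau> * l)) * of_real (?P l $ y))"
    unfolding F_def using s0 by (intro sum.cong) (simp_all add: field_simps)
  also have "\<dots> = (\<gamma> *s axis y 1) $ y"
    unfolding \<gamma>(2)[symmetric] transition_matrix_axis[OF assms(1)] by (simp add: complex_vec_def)
  finally have F0: "norm (F 0) = 1" using \<gamma>(1) by (simp add: axis_def)
  have contF: "isCont (\<lambda>z. norm (F z)) 0"
    unfolding F_def cis_conv_exp by (intro continuous_intros)
  show ?thesis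
    unfolding pretty_good_state_transfer_def
  proof (intro allI impI)
    fix \<epsilon> :: real assume "\<epsilon> > 0"
    then obtain \<delta> where \<delta>: "\<delta> > 0" "\<And>z. \<bar>z\<bar> < \<delta> \<Longrightarrow> \<bar>norm (F z) - norm (F 0)\<bar> < \<epsilon>"
      using contF unfolding continuous_at_eps_delta by (auto simp: dist_real_def)
    \<comment> \<open>The multiples of an irrational number are dense modulo 1; the target is chosen
      so that the error \<open>z\<close> below is small.\<close>
    obtain h n where hn: "\<bar>of_int n * s - of_int h - (- (s / (4 * of_int g)))\<bar> < \<delta>"
      using sequence_of_fractional_parts_is_dense[OF s_irr \<delta>(1)] by metis
    define z where "z = (of_int n + 1 / (4 * of_int g)) * s - of_int h"
    have z: "\<bar>z\<bar> < \<delta>" using hn by (simp add: z_def algebra_simps)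
    \<comment> \<open>The summand with \<open>n\<close> alters the phase \<open>t * l / 2\<close> by
      a multiple of \<open>2 * pi\<close>, even if \<open>l\<close> is a half-integer. The phase
      \<open>t * l * s / 2\<close> equals \<open>2 * pi * p l * (z + h)\<close>, where the integer
      \<open>h\<close> drops out.\<close>
    define t where "t = 2 * (\<tau> + 4 * pi * of_int n)"
    have phase: "cis (- (t * (l * ((1 + s) / 2)))) = cis (- (\<tau> * l)) * cis (- (2 * pi * of_int (p l) * z))"
      "cis (- (t * (l * ((1 - s) / 2)))) = cis (- (\<tau> * l)) * cis (2 * pi * of_int (p l) * z)"
      if "l \<in> ?S" for l
    proof -
      have pl: "real_of_int (p l) = 2 * l" using p[OF that] by simp
      have e: "- (t * (l * ((1 + s) / 2))) = - (\<tau> * l) + - (2 * pi * of_int (p l) * z) +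
          2 * pi * of_int (- (p l * (n + h)))"
        using g by (simp add: pl t_def \<tau>_def z_def field_simps)
      have e': "- (t * (l * ((1 - s) / 2))) = - (\<tau> * l) + 2 * pi * of_int (p l) * z +
          2 * pi * of_int (p l * (h - n))"
        using g by (simp add: pl t_def \<tau>_def z_def field_simps)
      show "cis (- (t * (l * ((1 + s) / 2)))) = cis (- (\<tau> * l)) * cis (- (2 * pi * of_int (p l) * z))"
        unfolding e cis_mult[symmetric] by (subst cis_multiple_2pi) simp_all
      show "cis (- (t * (l * ((1 - s) / 2)))) = cis (- (\<tau> * l)) * cis (2 * pi * of_int (p l) * z)"
        unfolding e' cis_mult[symmetric] by (subst cis_multiple_2pi) simp_all
    qed
    have "(transition_matrix (neighborhood_corona G1 (edgeless :: 'm \<Rightarrow> 'm \<Rightarrow> bool)) t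
        *v axis (x, None) 1) $ (y, None) = F z"
    proof -
      have roots: "((1 + s) / 2)\<^sup>2 = (1 + s) / 2 + real CARD('m)"
        "((1 - s) / 2)\<^sup>2 = (1 - s) / 2 + real CARD('m)" "(1 + s) / 2 \<noteq> (1 - s) / 2"
        using s2 s0 by (simp_all add: power_divide power2_sum power2_diff field_simps)
      have difference: "(1 + s) / 2 - (1 - s) / 2 = s" by (simp add: field_simps)
      show ?thesis
        unfolding corona_transition_entry[OF assms(1) roots] F_def difference
        by (intro sum.cong refl, simp only: phase, simp add: right_diff_distrib mult_ac)
    qed
    moreover have "norm (F z) > 1 - \<epsilon>" using \<delta>(2)[OF z] F0 by simp
    ultimately show "\<exists>\<tau>. norm ((transition_matrix
        (neighborhood_corona G1 (edgeless :: 'm \<Rightarrow> 'm \<Rightarrow> bool)) \<tau> *v axis (x, None) 1) $ (y, None)) > 1 - \<epsilon>"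
      by metis
  qed
qed

end
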